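(* Let $R$ be an integral domain and $A$ a cellular algebra over $R$. Suppose that $A$ is equipped with a family of Jucys-Murphy elements $L_1,\ldots,L_m$ which satisfies the separation condition. If the center of $A$ consists of the symmetric polynomials in the Jucys-Murphy elements, i.e. $Z(A)=\{p(L_1,\ldots,L_m)\mid p\in R[X_1,\ldots,X_m]\text{ symmetric}\}$, then for arbitrary $\lambda,\mu\in\Lambda$ with $\lambda\ne\mu$, the family $\{c_\lambda(i)\mid 1\le i\le m\}$ cannot be obtained from the family $\{c_\mu(i)\mid 1\le i\le m\}$ by permutations, i.e. there is no permutation $\sigma$ of $\{1,\ldots,m\}$ with $c_\lambda(i)=c_\mu(\sigma(i))$ for all $i$.
   Context: Cellular algebra (Graham-Lehrer): an associative unital $R$-algebra $A$ with cell datum $(\Lambda,M,C,i)$ such that: (C1) $\Lambda$ is a finite poset; to each $\lambda\in\Lambda$ is associated a (non-empty) finite set $M(\lambda)$; $A$ has an $R$-basis $\{C_{S,T}^\lambda\mid S,T\in M(\lambda),\lambda\in\Lambda\}$. (C2) The map $i$ is an $R$-linear anti-automorphism of $A$ with $i^2=\mathrm{id}$ sending $C_{S,T}^\lambda$ to $C_{T,S}^\lambda$. (C3) For $\lambda\in\Lambda$, $S,T\in M(\lambda)$ and $a\in A$, $aC_{S,T}^\lambda\equiv\sum_{S'\in M(\lambda)}r_a(S',S)C_{S',T}^\lambda \pmod{A(<\lambda)}$, where $r_a(S',S)\in R$ is independent of $T$ and $A(<\lambda)$ is the $R$-submodule of $A$ generated by $\{C_{S'',T''}^\mu\mid S'',T''\in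 M(\mu),\ \mu<\lambda\}$. Each $M(\lambda)$ is assumed to be a poset with an order $\le_\lambda$. The disjoint union $M(\Lambda)=\bigsqcup_{\lambda\in\Lambda}M(\lambda)$ is a poset with the order: $S\le T$ iff $S\le_\lambda T$ when $S,T\in M(\lambda)$ lie in the same set, and $S\le T$ iff $\lambda\le\mu$ when $S\in M(\lambda)$, $T\in M(\mu)$ with $\lambda\ne\mu$. $K$ is the field of fractions of $R$, $A_K=A\otimes_RK$, and $A$ is regarded as a subalgebra of $A_K$. Jucys-Murphy elements (Mathas): elements $L_1,\ldots,L_m$ of $A$ such that (a) $L_iL_j=L_jL_i$ for all $1\le i,j\le m$; (b) $i(L_j)=L_j$ for $j=1,\ldots,m$; (c) for all $\lambda\in\Lambda$, $S,T\in M(\lambda)$ and $i=1,\ldots,m$, $C_{S,T}^\lambda L_i\equiv c_T(i)C_{S,T}^\lambda+\sum_{V<T}r_{L_i}(V,T)C_{S,V}^\lambda \pmod{A(<\lambda)}$ (sum over $V\in M(\lambda)$ with $V<T$), where $c_T(i)\in R$ and $r_{L_i}(V,T)\in R$. The element $c_T(i)$ is called the content of $T$ at $i$. Separation condition: for any $S,T\in M(\Lambda)$ with $S\le T$ and $S\ne T$ there exists some $i$ with $1\le i\le m$ such that $c_S(i)\ne c_T(i)$. Notation $c_\lambda(i)$: when every symmetric polynomial in $L_1,\ldots,L_m$ belongs to the center of $A_K$ (as is the case under the hypothesis on $Z(A)$ in the claim), for every $\lambda\in\Lambda$ and $S,T\in M(\lambda)$ the families $\{c_S(i)\mid 1\le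 i\le m\}$ and $\{c_T(i)\mid 1\le i\le m\}$ coincide up to order (as multisets). Any one of them is denoted by $\{c_\lambda(i)\mid 1\le i\le m\}$; i.e. one may put $c_\lambda(i)=c_T(i)$ for any fixed choice of $T\in M(\lambda)$. *)

theory Defs
  imports Complex_Main "HOL-Library.Poly_Mapping" "HOL-Combinatorics.Permutations"
begin

definition partial_orderp_on :: "'b set \<Rightarrow> ('b \<Rightarrow> 'b \<Rightarrow> bool) \<Rightarrow> bool" where
  "partial_orderp_on X le \<longleftrightarrow> reflp_on X le \<and> transp_on X le \<and> antisymp_on X le"

definition ring_center :: "'a::ring set" where
  "ring_center = {z. \<forall>a. z * a = a * z}"

text \<open>
  The sort \<open>{ring, monoid_mult}\<close> describes arbitrary unital associative rings; unlike
  \<open>ring_1\<close> it does not exclude the zero ring.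
\<close>

locale unital_algebra = module scale
  for scale :: "'r::comm_ring_1 \<Rightarrow> 'a::{ring,monoid_mult} \<Rightarrow> 'a" (infixr \<open>*s\<close> 75) +
  assumes scale_mult_left: "(r *s x) * y = r *s (x * y)"
    and scale_mult_right: "x * (r *s y) = r *s (x * y)"

text \<open>The submodule \<open>A(< \<nu>)\<close>.\<close>

definition (in module) lower ::
    "'l set \<Rightarrow> ('l \<Rightarrow> 'l \<Rightarrow> bool) \<Rightarrow> ('l \<Rightarrow> 't set) \<Rightarrow> ('l \<Rightarrow> 't \<Rightarrow> 't \<Rightarrow> 'b) \<Rightarrow> 'l \<Rightarrow> 'b set" where
  "lower \<Lambda> le M C \<nu> =
     span {C \<mu> S T |\<mu> S T. \<mu> \<in> \<Lambda> \<and> le \<mu> \<nu> \<and> \<mu> \<noteq> \<nu> \<and> S \<in> M \<mu> \<and> T \<in> M \<mu>}"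

text \<open>
  A cellular algebra with cell datum \<open>(\<Lambda>, M, C, star)\<close>, the poset \<open>\<Lambda>\<close> being ordered by \<open>le\<close>.
  The sets \<open>M \<nu>\<close> need not be disjoint: an element \<open>S\<close> of \<open>M \<nu>\<close> is always accompanied by its
  shape \<open>\<nu>\<close>, so that the disjoint union of the \<open>M \<nu>\<close> is \<open>Sigma \<Lambda> M\<close>.  The element
  \<open>coef \<nu> a S' S\<close> is the coefficient \<open>r\<^sub>a(S', S)\<close> of the cell module of \<open>\<nu>\<close>; since the \<open>C \<nu> S T\<close>
  form a basis, it is determined by the other parameters for \<open>\<nu> \<in> \<Lambda>\<close> and \<open>S, S' \<in> M \<nu>\<close>.
\<close>

locale cellular_algebra = unital_algebra scale
  for scale :: "'r::comm_ring_1 \<Rightarrow> 'a::{ring,monoid_mult} \<Rightarrow> 'a" (infixr \<open>*s\<close> 75) +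
  fixes \<Lambda> :: "'l set" and le :: "'l \<Rightarrow> 'l \<Rightarrow> bool"
    and M :: "'l \<Rightarrow> 't set" and C :: "'l \<Rightarrow> 't \<Rightarrow> 't \<Rightarrow> 'a"
    and star :: "'a \<Rightarrow> 'a"
    and coef :: "'l \<Rightarrow> 'a \<Rightarrow> 't \<Rightarrow> 't \<Rightarrow> 'r"
  assumes finite_shapes: "finite \<Lambda>"
    and shapes_order: "partial_orderp_on \<Lambda> le"
    and finite_M: "\<nu> \<in> \<Lambda> \<Longrightarrow> finite (M \<nu>)"
    and M_nonempty: "\<nu> \<in> \<Lambda> \<Longrightarrow> M \<nu> \<noteq> {}"
    and basis_inj: "inj_on (\<lambda>(\<nu>, S, T). C \<nu> S T) (SIGMA \<nu>:\<Lambda>. M \<nu> \<times> M \<nu>)"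
    and basis_independent: "independent ((\<lambda>(\<nu>, S, T). C \<nu> S T) ` (SIGMA \<nu>:\<Lambda>. M \<nu> \<times> M \<nu>))"
    and basis_span: "span ((\<lambda>(\<nu>, S, T). C \<nu> S T) ` (SIGMA \<nu>:\<Lambda>. M \<nu> \<times> M \<nu>)) = UNIV"
    and star_linear: "module_hom scale scale star"
    and star_mult: "star (x * y) = star y * star x"
    and star_star: "star (star x) = x"
    and star_C: "\<nu> \<in> \<Lambda> \<Longrightarrow> S \<in> M \<nu> \<Longrightarrow> T \<in> M \<nu> \<Longrightarrow> star (C \<nu> S T) = C \<nu> T S"
    and mult_C: "\<nu> \<in> \<Lambda> \<Longrightarrow> S \<in> M \<nu> \<Longrightarrow> T \<in> M \<nu> \<Longrightarrow>
      a * C \<nu> S T - (\<Sum>S'\<in>M \<nu>. coef \<nu> a S' S *s C \<nu> S' T)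
        \<in> lower \<Lambda> le M C \<nu>"

text \<open>
  Jucys-Murphy elements \<open>L 1, \<dots>, L m\<close>, where \<open>leM \<nu>\<close> is the order of \<open>M \<nu>\<close> and \<open>c \<nu> T i\<close> is the
  content at \<open>i\<close> of \<open>T \<in> M \<nu>\<close>.
\<close>

locale jucys_murphy = cellular_algebra scale \<Lambda> le M C star coef
  for scale :: "'r::comm_ring_1 \<Rightarrow> 'a::{ring,monoid_mult} \<Rightarrow> 'a" (infixr \<open>*s\<close> 75)
    and \<Lambda> :: "'l set" and le and M :: "'l \<Rightarrow> 't set" and C and star and coef +
  fixes leM :: "'l \<Rightarrow> 't \<Rightarrow> 't \<Rightarrow> bool"
    and m :: nat and L :: "nat \<Rightarrow> 'a" and c :: "'l \<Rightarrow> 't \<Rightarrow> nat \<Rightarrow> 'r"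
  assumes M_order: "\<nu> \<in> \<Lambda> \<Longrightarrow> partial_orderp_on (M \<nu>) (leM \<nu>)"
    and L_commute: "i \<in> {1..m} \<Longrightarrow> j \<in> {1..m} \<Longrightarrow> L i * L j = L j * L i"
    and star_L: "j \<in> {1..m} \<Longrightarrow> star (L j) = L j"
    and C_mult_L: "\<nu> \<in> \<Lambda> \<Longrightarrow> S \<in> M \<nu> \<Longrightarrow> T \<in> M \<nu> \<Longrightarrow> i \<in> {1..m} \<Longrightarrow>
      C \<nu> S T * L i
        - (c \<nu> T i *s C \<nu> S T
           + (\<Sum>V | V \<in> M \<nu> \<and> leM \<nu> V T \<and> V \<noteq> T. coef \<nu> (L i) V T *s C \<nu> S V)) \<in> lower \<Lambda> le M C \<nu>"

text \<open>The order on the disjoint union of the \<open>M \<nu>\<close>.\<close>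

definition tableau_le ::
    "('l \<Rightarrow> 'l \<Rightarrow> bool) \<Rightarrow> ('l \<Rightarrow> 't \<Rightarrow> 't \<Rightarrow> bool) \<Rightarrow> 'l \<times> 't \<Rightarrow> 'l \<times> 't \<Rightarrow> bool" where
  "tableau_le le leM = (\<lambda>(\<nu>, S) (\<mu>, T). if \<nu> = \<mu> then leM \<nu> S T else le \<nu> \<mu>)"

definition separation_condition ::
    "'l set \<Rightarrow> ('l \<Rightarrow> 'l \<Rightarrow> bool) \<Rightarrow> ('l \<Rightarrow> 't set) \<Rightarrow> ('l \<Rightarrow> 't \<Rightarrow> 't \<Rightarrow> bool) \<Rightarrow> nat
      \<Rightarrow> ('l \<Rightarrow> 't \<Rightarrow> nat \<Rightarrow> 'r) \<Rightarrow> bool" where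
  "separation_condition \<Lambda> le M leM m c \<longleftrightarrow>
     (\<forall>(\<nu>, S) \<in> Sigma \<Lambda> M. \<forall>(\<mu>, T) \<in> Sigma \<Lambda> M.
        tableau_le le leM (\<nu>, S) (\<mu>, T) \<and> (\<nu>, S) \<noteq> (\<mu>, T) \<longrightarrow>
        (\<exists>i\<in>{1..m}. c \<nu> S i \<noteq> c \<mu> T i))"

text \<open>
  Polynomials in \<open>X\<^sub>1, \<dots>, X\<^sub>m\<close> are finitely supported maps from monomials to coefficients, a monomial
  being the finitely supported map of its exponents.
\<close>

type_synonym 'r mpolynomial = "(nat \<Rightarrow>\<^sub>0 nat) \<Rightarrow>\<^sub>0 'r"

definition polys_in :: "nat \<Rightarrow> 'r::zero mpolynomial set" where
  "polys_in m = {p. \<forall>e \<in> Poly_Mapping.keys p. Poly_Mapping.keys e \<subseteq> {1..m}}"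

text \<open>\<open>map_key \<sigma> e\<close> is the monomial with exponents \<open>e (\<sigma> i)\<close>, for injective \<open>\<sigma>\<close>.\<close>

definition symmetric_polys :: "nat \<Rightarrow> 'r::zero mpolynomial set" where
  "symmetric_polys m =
     {p \<in> polys_in m. \<forall>\<sigma> e. \<sigma> permutes {1..m} \<longrightarrow>
        Poly_Mapping.lookup p (Poly_Mapping.map_key \<sigma> e) = Poly_Mapping.lookup p e}"

text \<open>
  The factors of a monomial are multiplied in increasing order of the indices of the variables, as
  the algebra is not assumed commutative; for commuting \<open>L i\<close> the order does not matter.
\<close>

definition poly_at ::
    "('r::zero \<Rightarrow> 'a::{ring,monoid_mult} \<Rightarrow> 'a) \<Rightarrow> nat \<Rightarrow> (nat \<Rightarrow> 'a) \<Rightarrow> 'r mpolynomial \<Rightarrow> 'a" where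
  "poly_at scale m L p =
     (\<Sum>e \<in> Poly_Mapping.keys p.
        scale (Poly_Mapping.lookup p e) (\<Prod>i\<leftarrow>[1..<Suc m]. L i ^ Poly_Mapping.lookup e i))"

end

theory Submission
  imports Defs
begin

text \<open>
  Write \<open>r\<^sub>a\<close> for the matrices by which \<open>a\<close> acts on the cell modules; on the cell module of \<open>\<kappa>\<close> it is
  \<open>coef \<kappa> a\<close>.  These matrices turn the claim into the existence of a single element: a central \<open>z\<close>
  that acts on the cell module of \<open>\<nu>\<close> as a scalar \<open>d \<noteq> 0\<close> and as zero on all others.  By
  assumption such a \<open>z\<close> is a symmetric polynomial \<open>p\<close> in the \<open>L i\<close>.  The \<open>L i\<close> act on cell modules by
  triangular matrices with the contents on the diagonal, so \<open>p\<close> takes the value \<open>d\<close> at the contents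
  of \<open>S\<close> and \<open>0\<close> at those of \<open>T\<close>.  A symmetric polynomial does not distinguish families that are
  permutations of each other, so these two families are not.

  The element \<open>z\<close> exists because the cell modules together are faithful
  (\<open>cell_modules_faithful\<close>): the rank of the algebra is the number of entries of all the matrices
  \<open>r\<^sub>a\<close>, so over the field of fractions \<open>a \<mapsto> r\<^sub>a\<close> is an isomorphism onto a product of matrix
  algebras, and clearing denominators gives \<open>z\<close> in the algebra itself (\<open>scaled_cell_block_unit\<close>).
  Counting equations over the domain replaces the passage to fractions.  Faithfulness also
  makes \<open>z\<close> central, as scalar matrices commute with everything.

  Separation enters only in the proof of faithfulness, which comes down to the nondegeneracy of the
  bilinear form of each cell module (\<open>form_radical_trivial\<close>).  If the form of \<open>\<nu>\<close> is
  degenerate, its radical is a nonzero submodule and contains a joint eigenvector \<open>v\<close> of the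
  \<open>L i\<close>, with the contents of some \<open>S \<in> M \<nu>\<close> as eigenvalues (\<open>joint_eigenvector\<close>).  As \<open>1\<close> does
  not kill \<open>v\<close>, some basis element \<open>C \<mu> U T\<close> does not; for \<open>\<mu>\<close> and then \<open>T\<close> minimal, letting
  \<open>C \<mu> U T * L i\<close> act on \<open>v\<close> shows that \<open>T\<close> has the same contents as \<open>S\<close>.  The basis elements of
  shape \<open>\<nu>\<close> kill the radical and the action on the cell module of \<open>\<nu>\<close> is zero for shapes not above
  \<open>\<nu>\<close>, so \<open>\<nu> < \<mu>\<close> and \<open>S < T\<close>, against separation.
\<close>

section \<open>Finite posets and linear systems over a domain\<close>

lemma finite_minimal:
  assumes "partial_orderp_on X ord" "finite X" "D \<subseteq> X" "D \<noteq> {}"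
  obtains S where "S \<in> D" "\<And>T. T \<in> D \<Longrightarrow> ord T S \<Longrightarrow> T = S"
proof -
  have order: "transp_on D ord" "antisymp_on D ord"
    using assms(1,3) transp_on_subset antisymp_on_subset unfolding partial_orderp_on_def by auto
  note trans = transp_onD[OF order(1)] and antisym = antisymp_onD[OF order(2)]
  have "\<exists>S\<in>D. \<forall>T\<in>D. T \<noteq> S \<longrightarrow> \<not> (ord T S \<and> T \<noteq> S)"
  proof (rule Finite_Set.bex_min_element)
    show "finite D" by (rule finite_subset[OF assms(3,2)])
    show "asymp_on D (\<lambda>T S. ord T S \<and> T \<noteq> S)"
      by (rule asymp_onI) (auto dest: antisym)
    show "transp_on D (\<lambda>T S. ord T S \<and> T \<noteq> S)"
    proof (rule transp_onI)
      fix x y z assume "x \<in> D" "y \<in> D" "z \<in> D" "ord x y \<and> x \<noteq> y" "ord y z \<and> y \<noteq> z"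
      then show "ord x z \<and> x \<noteq> z" using trans[of x y z] antisym[of x y] by auto
    qed
  qed fact
  then obtain S where "S \<in> D" "\<forall>T\<in>D. T \<noteq> S \<longrightarrow> \<not> (ord T S \<and> T \<noteq> S)" by (rule bexE)
  then show thesis by (intro that[of S]) auto
qed

lemma finite_maximal:
  assumes "partial_orderp_on X ord" "finite X" "D \<subseteq> X" "D \<noteq> {}"
  obtains S where "S \<in> D" "\<And>T. T \<in> D \<Longrightarrow> ord S T \<Longrightarrow> T = S"
proof -
  have dual: "partial_orderp_on X (\<lambda>a b. ord b a)"
    using assms(1) unfolding partial_orderp_on_def
    by (intro conjI reflp_onI transp_onI antisymp_onI; elim conjE)
      (erule (1) reflp_onD, erule (5) transp_onD, erule (3) antisymp_onD)
  show thesis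
    by (rule finite_minimal[OF dual assms(2-4)]) (rule that)
qed

text \<open>
  Gaussian elimination without division: the pivot multiplies the other vectors instead of
  dividing the pivot row.
\<close>

lemma more_unknowns_than_equations:
  fixes f :: "'i \<Rightarrow> 'j \<Rightarrow> 'r::idom"
  assumes "finite J" "finite I" "card J < card I"
  obtains a where "\<And>j. j \<in> J \<Longrightarrow> (\<Sum>i\<in>I. a i * f i j) = 0" "\<exists>i\<in>I. a i \<noteq> 0"
proof -
  have "\<exists>a. (\<forall>j\<in>J. (\<Sum>i\<in>I. a i * f i j) = 0) \<and> (\<exists>i\<in>I. a i \<noteq> 0)"
    using assms
  proof (induction J arbitrary: I f rule: finite_induct)
    case empty
    then have "I \<noteq> {}" by auto
    then show ?case by (auto intro!: exI[of _ "\<lambda>_. 1"])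
  next
    case (insert j J)
    show ?case
    proof (cases "\<forall>i\<in>I. f i j = 0")
      case True
      have "card J < card I" using insert by simp
      then show ?thesis using insert.IH[of I f] insert.prems True by auto
    next
      case False
      then obtain p where p: "p \<in> I" "f p j \<noteq> 0" by blast
      let ?I = "I - {p}"
      have "finite ?I" "card J < card ?I" using insert.prems insert.hyps p by auto
      obtain a where a: "\<forall>k\<in>J. (\<Sum>i\<in>?I. a i * (f p j * f i k - f i j * f p k)) = 0" "\<exists>i\<in>?I. a i \<noteq> 0"
        using insert.IH[of ?I "\<lambda>i k. f p j * f i k - f i j * f p k"]
          \<open>finite ?I\<close> \<open>card J < card ?I\<close> by blast
      \<comment> \<open>Solving the equation of \<open>j\<close> for the unknown \<open>p\<close> after scaling the others by the pivot \<open>f p j\<close>.\<close>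
      define b where "b i = (if i = p then - (\<Sum>i\<in>?I. a i * f i j) else a i * f p j)" for i
      have b: "(\<Sum>i\<in>I. b i * f i k) = (\<Sum>i\<in>?I. a i * (f p j * f i k - f i j * f p k))" for k
      proof -
        have "(\<Sum>i\<in>I. b i * f i k) = b p * f p k + (\<Sum>i\<in>?I. b i * f i k)"
          using insert.prems p by (simp add: sum.remove)
        also have "(\<Sum>i\<in>?I. b i * f i k) = (\<Sum>i\<in>?I. a i * f p j * f i k)"
          by (rule sum.cong) (auto simp: b_def)
        finally show ?thesis
          by (simp add: b_def right_diff_distrib sum_subtractf sum_distrib_right mult.assoc)
      qed
      have "(\<Sum>i\<in>I. b i * f i k) = 0" if "k \<in> insert j J" for k
        using that a(1) by (cases "k = j") (simp_all add: b mult.commute[of "f p j"])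
      moreover have "\<exists>i\<in>I. b i \<noteq> 0"
        using a(2) p by (auto simp: b_def)
      ultimately show ?thesis by blast
    qed
  qed
  then show thesis using that by blast
qed

section \<open>Coordinates in the cellular basis\<close>

context cellular_algebra
begin

abbreviation low :: "'l \<Rightarrow> 'a set" where
  "low \<equiv> lower \<Lambda> le M C"

definition coord :: "'l \<Rightarrow> 't \<Rightarrow> 't \<Rightarrow> 'a \<Rightarrow> 'r" where
  "coord \<kappa> S T a =
     representation ((\<lambda>(\<nu>, S, T). C \<nu> S T) ` (SIGMA \<nu>:\<Lambda>. M \<nu> \<times> M \<nu>)) a (C \<kappa> S T)"

lemma shape_le_trans: "\<kappa> \<in> \<Lambda> \<Longrightarrow> \<nu> \<in> \<Lambda> \<Longrightarrow> \<mu> \<in> \<Lambda> \<Longrightarrow> le \<kappa> \<nu> \<Longrightarrow> le \<nu> \<mu> \<Longrightarrow> le \<kappa> \<mu>"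
  and shape_le_antisym: "\<kappa> \<in> \<Lambda> \<Longrightarrow> \<nu> \<in> \<Lambda> \<Longrightarrow> le \<kappa> \<nu> \<Longrightarrow> le \<nu> \<kappa> \<Longrightarrow> \<kappa> = \<nu>"
  and shape_le_refl: "\<kappa> \<in> \<Lambda> \<Longrightarrow> le \<kappa> \<kappa>"
  using shapes_order unfolding partial_orderp_on_def
  by (blast dest: transp_onD antisymp_onD reflp_onD)+

lemma finite_index: "finite (SIGMA \<nu>:\<Lambda>. M \<nu> \<times> M \<nu>)"
  using finite_shapes finite_M by blast

lemma coord_add: "coord \<kappa> S T (a + b) = coord \<kappa> S T a + coord \<kappa> S T b"
  and coord_diff: "coord \<kappa> S T (a - b) = coord \<kappa> S T a - coord \<kappa> S T b"
  and coord_scale: "coord \<kappa> S T (r *s a) = r * coord \<kappa> S T a"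
  and coord_zero: "coord \<kappa> S T 0 = 0"
  and coord_sum: "coord \<kappa> S T (sum f X) = (\<Sum>x\<in>X. coord \<kappa> S T (f x))"
  unfolding coord_def
  using basis_independent basis_span
  by (simp_all add: representation_add representation_diff representation_scale
      representation_zero representation_sum)

lemma coord_C:
  assumes "\<kappa> \<in> \<Lambda>" "S \<in> M \<kappa>" "T \<in> M \<kappa>" "\<nu> \<in> \<Lambda>" "U \<in> M \<nu>" "V \<in> M \<nu>"
  shows "coord \<kappa> S T (C \<nu> U V) = (if \<nu> = \<kappa> \<and> U = S \<and> V = T then 1 else 0)"
proof -
  have "C \<kappa> S T = C \<nu> U V \<longleftrightarrow> \<nu> = \<kappa> \<and> U = S \<and> V = T"
    using inj_onD[OF basis_inj, of "(\<kappa>, S, T)" "(\<nu>, U, V)"] assms by auto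
  moreover have "C \<nu> U V \<in> (\<lambda>(\<nu>, S, T). C \<nu> S T) ` (SIGMA \<nu>:\<Lambda>. M \<nu> \<times> M \<nu>)"
    using assms by force
  ultimately show ?thesis
    unfolding coord_def by (simp add: representation_basis[OF basis_independent])
qed

lemma coord_expand: "a = (\<Sum>(\<kappa>, S, T)\<in>(SIGMA \<nu>:\<Lambda>. M \<nu> \<times> M \<nu>). coord \<kappa> S T a *s C \<kappa> S T)"
proof -
  let ?I = "SIGMA \<nu>:\<Lambda>. M \<nu> \<times> M \<nu>" and ?f = "\<lambda>(\<nu>, S, T). C \<nu> S T"
  have "a = (\<Sum>b\<in>?f ` ?I. representation (?f ` ?I) a b *s b)"
    using sum_representation_eq[OF basis_independent, of a "?f ` ?I"] basis_span finite_index
    by simp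
  also have "\<dots> = (\<Sum>i\<in>?I. representation (?f ` ?I) a (?f i) *s ?f i)"
    using basis_inj by (simp add: sum.reindex)
  finally show ?thesis
    unfolding coord_def by (simp add: case_prod_unfold)
qed

lemma coord_eqI:
  assumes "\<And>\<kappa> S T. \<kappa> \<in> \<Lambda> \<Longrightarrow> S \<in> M \<kappa> \<Longrightarrow> T \<in> M \<kappa> \<Longrightarrow> coord \<kappa> S T a = coord \<kappa> S T b"
  shows "a = b"
  by (subst coord_expand[of a], subst coord_expand[of b]) (auto intro!: sum.cong simp: assms)

lemma lower_induct [consumes 1, case_names zero add C]:
  assumes "x \<in> low \<nu>"
    and "P 0"
    and "\<And>a b. P a \<Longrightarrow> P b \<Longrightarrow> P (a + b)"
    and "\<And>r \<kappa> S T. \<kappa> \<in> \<Lambda> \<Longrightarrow> le \<kappa> \<nu> \<Longrightarrow> \<kappa> \<noteq> \<nu> \<Longrightarrow> S \<in> M \<kappa> \<Longrightarrow> T \<in> M \<kappa> \<Longrightarrow> P (r *s C \<kappa> S T)"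
  shows "P x"
  using assms(1) unfolding lower_def
proof (induction rule: span_induct_alt)
  case base
  show ?case by (rule assms(2))
next
  case (step r x y)
  then show ?case using assms(3,4) by blast
qed

lemma C_in_lower:
  "\<kappa> \<in> \<Lambda> \<Longrightarrow> le \<kappa> \<nu> \<Longrightarrow> \<kappa> \<noteq> \<nu> \<Longrightarrow> S \<in> M \<kappa> \<Longrightarrow> T \<in> M \<kappa> \<Longrightarrow> C \<kappa> S T \<in> low \<nu>"
  unfolding lower_def by (rule span_base) blast

lemma lower_add: "x \<in> low \<nu> \<Longrightarrow> y \<in> low \<nu> \<Longrightarrow> x + y \<in> low \<nu>"
  and lower_scale: "x \<in> low \<nu> \<Longrightarrow> r *s x \<in> low \<nu>"
  and lower_zero: "0 \<in> low \<nu>"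
  and lower_sum: "(\<And>i. i \<in> X \<Longrightarrow> f i \<in> low \<nu>) \<Longrightarrow> sum f X \<in> low \<nu>"
  unfolding lower_def by (blast intro: span_add span_scale span_zero span_sum)+

lemma lower_mono:
  assumes "x \<in> low \<kappa>" "\<kappa> \<in> \<Lambda>" "\<nu> \<in> \<Lambda>" "le \<kappa> \<nu>"
  shows "x \<in> low \<nu>"
  using assms(1)
proof (induction rule: lower_induct)
  case (C r \<rho> S T)
  then have "le \<rho> \<nu>" "\<rho> \<noteq> \<nu>" 
    using assms shape_le_trans shape_le_antisym by metis+
  with C show ?case by (intro lower_scale C_in_lower)
qed (auto intro: lower_zero lower_add)

lemma coord_lower:
  assumes "x \<in> low \<nu>" "\<kappa> \<in> \<Lambda>" "S \<in> M \<kappa>" "T \<in> M \<kappa>" "\<not> (le \<kappa> \<nu> \<and> \<kappa> \<noteq> \<nu>)"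
  shows "coord \<kappa> S T x = 0"
  using assms(1)
proof (induction rule: lower_induct)
  case (C r \<rho> U V)
  then show ?case using assms(2-) by (auto simp: coord_scale coord_C)
qed (auto simp: coord_zero coord_add)

lemma lower_mult_left:
  assumes "x \<in> low \<nu>" "\<nu> \<in> \<Lambda>"
  shows "a * x \<in> low \<nu>"
  using assms(1)
proof (induction rule: lower_induct)
  case (C r \<kappa> S T)
  have "a * C \<kappa> S T = (a * C \<kappa> S T - (\<Sum>S'\<in>M \<kappa>. coef \<kappa> a S' S *s C \<kappa> S' T))
      + (\<Sum>S'\<in>M \<kappa>. coef \<kappa> a S' S *s C \<kappa> S' T)"
    by simp
  also have "\<dots> \<in> low \<nu>"
    using C assms(2) mult_C[of \<kappa> S T a]
    by (intro lower_add lower_sum lower_scale C_in_lower) (auto intro: lower_mono)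
  finally show ?case
    using C by (simp add: scale_mult_right lower_scale)
qed (auto simp: distrib_left intro: lower_zero lower_add)

lemma star_add: "star (x + y) = star x + star y"
  and star_diff: "star (x - y) = star x - star y"
  and star_zero: "star 0 = 0"
  and star_scale: "star (r *s x) = r *s star x"
  and star_sum: "star (sum f X) = (\<Sum>i\<in>X. star (f i))"
proof -
  interpret module_hom scale scale star by (rule star_linear)
  show "star (x + y) = star x + star y" "star (x - y) = star x - star y" "star 0 = 0"
      "star (r *s x) = r *s star x" "star (sum f X) = (\<Sum>i\<in>X. star (f i))"
    by (rule add diff zero scale sum)+
qed

lemma star_lower:
  assumes "x \<in> low \<nu>"
  shows "star x \<in> low \<nu>"
  using assms
  by (induction rule: lower_induct)
    (auto simp: star_zero star_add star_scale star_C intro: lower_zero lower_add lower_scale C_in_lower)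

text \<open>
  The right-handed form of \<open>mult_C\<close>, obtained by applying the anti-automorphism \<open>star\<close>.
\<close>

lemma C_mult:
  assumes "\<nu> \<in> \<Lambda>" "S \<in> M \<nu>" "T \<in> M \<nu>"
  shows "C \<nu> S T * b - (\<Sum>T'\<in>M \<nu>. coef \<nu> (star b) T' T *s C \<nu> S T') \<in> low \<nu>"
  using star_lower[OF mult_C[OF assms(1,3,2), of "star b"]] assms
  by (simp add: star_diff star_sum star_scale star_mult star_star star_C)

section \<open>Cell modules\<close>

lemma coord_mult_C:
  assumes "\<nu> \<in> \<Lambda>" "X \<in> M \<nu>" "V \<in> M \<nu>" "S \<in> M \<nu>" "T \<in> M \<nu>"
  shows "coord \<nu> X V (a * C \<nu> S T) = (if V = T then coef \<nu> a X S else 0)"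
proof -
  have "coord \<nu> X V (a * C \<nu> S T - (\<Sum>S'\<in>M \<nu>. coef \<nu> a S' S *s C \<nu> S' T)) = 0"
    by (rule coord_lower[OF mult_C]) (use assms in auto)
  then have "coord \<nu> X V (a * C \<nu> S T) = (\<Sum>S'\<in>M \<nu>. coef \<nu> a S' S * (if S' = X \<and> T = V then 1 else 0))"
    using assms by (simp add: coord_diff coord_sum coord_scale coord_C)
  also have "\<dots> = (\<Sum>S'\<in>M \<nu>. if S' = X then coef \<nu> a S' S * (if T = V then 1 else 0) else 0)"
    by (rule sum.cong) auto
  finally show ?thesis
    using assms finite_M by auto
qed

lemma coord_C_mult:
  assumes "\<nu> \<in> \<Lambda>" "X \<in> M \<nu>" "V \<in> M \<nu>" "S \<in> M \<nu>" "T \<in> M \<nu>"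
  shows "coord \<nu> X V (C \<nu> S T * b) = (if X = S then coef \<nu> (star b) V T else 0)"
proof -
  have "coord \<nu> X V (C \<nu> S T * b - (\<Sum>T'\<in>M \<nu>. coef \<nu> (star b) T' T *s C \<nu> S T')) = 0"
    by (rule coord_lower[OF C_mult]) (use assms in auto)
  then have "coord \<nu> X V (C \<nu> S T * b) = (\<Sum>T'\<in>M \<nu>. coef \<nu> (star b) T' T * (if S = X \<and> T' = V then 1 else 0))"
    using assms by (simp add: coord_diff coord_sum coord_scale coord_C)
  also have "\<dots> = (\<Sum>T'\<in>M \<nu>. if T' = V then coef \<nu> (star b) T' T * (if S = X then 1 else 0) else 0)"
    by (rule sum.cong) auto
  finally show ?thesis
    using assms finite_M by auto
qed

lemma coef_eq_coord:
  "\<nu> \<in> \<Lambda> \<Longrightarrow> X \<in> M \<nu> \<Longrightarrow> S \<in> M \<nu> \<Longrightarrow> coef \<nu> a X S = coord \<nu> X S (a * C \<nu> S S)"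
  by (simp add: coord_mult_C)

lemma coef_add: "\<nu> \<in> \<Lambda> \<Longrightarrow> X \<in> M \<nu> \<Longrightarrow> S \<in> M \<nu> \<Longrightarrow> coef \<nu> (a + b) X S = coef \<nu> a X S + coef \<nu> b X S"
  and coef_diff: "\<nu> \<in> \<Lambda> \<Longrightarrow> X \<in> M \<nu> \<Longrightarrow> S \<in> M \<nu> \<Longrightarrow> coef \<nu> (a - b) X S = coef \<nu> a X S - coef \<nu> b X S"
  and coef_scale: "\<nu> \<in> \<Lambda> \<Longrightarrow> X \<in> M \<nu> \<Longrightarrow> S \<in> M \<nu> \<Longrightarrow> coef \<nu> (r *s a) X S = r * coef \<nu> a X S"
  and coef_zero: "\<nu> \<in> \<Lambda> \<Longrightarrow> X \<in> M \<nu> \<Longrightarrow> S \<in> M \<nu> \<Longrightarrow> coef \<nu> 0 X S = 0"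
  and coef_one: "\<nu> \<in> \<Lambda> \<Longrightarrow> X \<in> M \<nu> \<Longrightarrow> S \<in> M \<nu> \<Longrightarrow> coef \<nu> 1 X S = (if X = S then 1 else 0)"
  and coef_sum: "\<nu> \<in> \<Lambda> \<Longrightarrow> X \<in> M \<nu> \<Longrightarrow> S \<in> M \<nu> \<Longrightarrow> coef \<nu> (sum f I) X S = (\<Sum>i\<in>I. coef \<nu> (f i) X S)"
  by (auto simp: coef_eq_coord distrib_right left_diff_distrib scale_mult_left sum_distrib_right
      coord_add coord_diff coord_scale coord_zero coord_sum coord_C)

lemma coef_mult:
  assumes "\<nu> \<in> \<Lambda>" "X \<in> M \<nu>" "S \<in> M \<nu>"
  shows "coef \<nu> (a * b) X S = (\<Sum>Y\<in>M \<nu>. coef \<nu> a X Y * coef \<nu> b Y S)"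
proof -
  let ?s = "\<Sum>Y\<in>M \<nu>. coef \<nu> b Y S *s C \<nu> Y S"
  have "coord \<nu> X S (a * (b * C \<nu> S S - ?s)) = 0"
    by (rule coord_lower[OF lower_mult_left[OF mult_C]]) (use assms in auto)
  then have "coef \<nu> (a * b) X S = coord \<nu> X S (a * ?s)"
    using assms by (simp add: coef_eq_coord coord_diff right_diff_distrib mult.assoc)
  also have "\<dots> = (\<Sum>Y\<in>M \<nu>. coef \<nu> b Y S * coef \<nu> a X Y)"
    using assms by (simp add: sum_distrib_left scale_mult_right coord_sum coord_scale coord_mult_C)
  finally show ?thesis by (simp add: mult.commute)
qed

text \<open>
  Evaluating \<open>C \<nu> S T * C \<nu> U V\<close> by its left and by its right factor shows that modulo lower terms
  it is a multiple of \<open>C \<nu> S V\<close> by a factor that depends only on \<open>T\<close> and \<open>U\<close>.  This factor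
  is the value \<open>\<phi>(T, U)\<close> of the bilinear form of Graham and Lehrer; the swap of \<open>T\<close> and \<open>U\<close> on the
  right-hand side, with an arbitrary \<open>V\<close>, expresses that \<open>\<phi>\<close> is symmetric.
\<close>

lemma coef_C:
  assumes "\<nu> \<in> \<Lambda>" "S \<in> M \<nu>" "T \<in> M \<nu>" "X \<in> M \<nu>" "U \<in> M \<nu>" "V \<in> M \<nu>"
  shows "coef \<nu> (C \<nu> S T) X U = (if X = S then coef \<nu> (C \<nu> V U) V T else 0)"
proof -
  have "coef \<nu> (C \<nu> S T) X U = coord \<nu> X V (C \<nu> S T * C \<nu> U V)"
    using assms by (simp add: coord_mult_C)
  then show ?thesis
    using assms by (simp add: coord_C_mult star_C)
qed

text \<open>
  A product \<open>C \<kappa> S T * C \<nu> U U\<close> lies in the span of the shapes below \<open>\<kappa>\<close>, hence has no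
  component of shape \<open>\<nu>\<close> unless \<open>\<nu>\<close> is below \<open>\<kappa>\<close>.
\<close>

lemma coef_C_eq_0:
  assumes "\<kappa> \<in> \<Lambda>" "S \<in> M \<kappa>" "T \<in> M \<kappa>" "\<nu> \<in> \<Lambda>" "X \<in> M \<nu>" "U \<in> M \<nu>" "\<not> le \<nu> \<kappa>"
  shows "coef \<nu> (C \<kappa> S T) X U = 0"
proof -
  have "coord \<nu> X U (C \<kappa> S T * C \<nu> U U - (\<Sum>T'\<in>M \<kappa>. coef \<kappa> (star (C \<nu> U U)) T' T *s C \<kappa> S T')) = 0"
    by (rule coord_lower[OF C_mult]) (use assms in auto)
  then have "coord \<nu> X U (C \<kappa> S T * C \<nu> U U) = 0"
    using assms shape_le_refl by (auto simp: coord_diff coord_sum coord_scale coord_C intro!: sum.neutral)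
  then show ?thesis using assms by (simp add: coord_mult_C)
qed

lemma coef_lower_eq_0:
  assumes "x \<in> low \<nu>" "\<nu> \<in> \<Lambda>" "X \<in> M \<nu>" "U \<in> M \<nu>"
  shows "coef \<nu> x X U = 0"
  using assms(1)
proof (induction rule: lower_induct)
  case (C r \<kappa> S T)
  then have "\<not> le \<nu> \<kappa>" using assms shape_le_antisym by blast
  with C show ?case using assms by (simp add: coef_scale coef_C_eq_0)
qed (use assms in \<open>auto simp: coef_zero coef_add\<close>)

text \<open>
  Elements of the cell module are coordinate vectors, taken to vanish outside \<open>M \<nu>\<close> so that
  equality of vectors is equality of functions.
\<close>

definition act :: "'l \<Rightarrow> 'a \<Rightarrow> ('t \<Rightarrow> 'r) \<Rightarrow> 't \<Rightarrow> 'r" where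
  "act \<nu> a x = (\<lambda>S. if S \<in> M \<nu> then \<Sum>T\<in>M \<nu>. coef \<nu> a S T * x T else 0)"

text \<open>
  The element \<open>C \<nu> U V\<close> sends \<open>x\<close> to the multiple of the unit vector at \<open>U\<close> by
  \<open>\<phi>(V, x)\<close>, so the common kernel of these elements is the radical of \<open>\<phi>\<close>.
\<close>

definition form_radical :: "'l \<Rightarrow> ('t \<Rightarrow> 'r) set" where
  "form_radical \<nu> = {x. (\<forall>T. T \<notin> M \<nu> \<longrightarrow> x T = 0) \<and>
     (\<forall>U\<in>M \<nu>. \<forall>V\<in>M \<nu>. act \<nu> (C \<nu> U V) x = (\<lambda>_. 0))}"

lemma act_add: "\<nu> \<in> \<Lambda> \<Longrightarrow> act \<nu> (a + b) x S = act \<nu> a x S + act \<nu> b x S"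
  and act_diff: "\<nu> \<in> \<Lambda> \<Longrightarrow> act \<nu> (a - b) x S = act \<nu> a x S - act \<nu> b x S"
  and act_scale: "\<nu> \<in> \<Lambda> \<Longrightarrow> act \<nu> (r *s a) x S = r * act \<nu> a x S"
  by (auto simp: act_def coef_add coef_diff coef_scale distrib_right left_diff_distrib sum.distrib
      sum_subtractf sum_distrib_left mult.assoc)

lemma act_zero: "\<nu> \<in> \<Lambda> \<Longrightarrow> act \<nu> 0 x S = 0"
  by (simp add: act_def coef_zero)

lemma act_sum: "\<nu> \<in> \<Lambda> \<Longrightarrow> act \<nu> (sum f X) x S = (\<Sum>i\<in>X. act \<nu> (f i) x S)"
  by (induction X rule: infinite_finite_induct) (simp_all add: act_zero act_add)

lemma act_smult: "act \<nu> a (\<lambda>T. r * x T) S = r * act \<nu> a x S"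
  by (simp add: act_def sum_distrib_left mult.left_commute)

lemma act_one:
  assumes "\<nu> \<in> \<Lambda>" "\<And>T. T \<notin> M \<nu> \<Longrightarrow> x T = 0"
  shows "act \<nu> 1 x = x"
proof
  fix S
  have "S \<in> M \<nu> \<Longrightarrow> (\<Sum>T\<in>M \<nu>. coef \<nu> 1 S T * x T) = (\<Sum>T\<in>M \<nu>. if T = S then x T else 0)"
    by (rule sum.cong) (use assms in \<open>auto simp: coef_one\<close>)
  then show "act \<nu> 1 x S = x S"
    using assms finite_M by (simp add: act_def)
qed

lemma act_mult: 
  assumes "\<nu> \<in> \<Lambda>"
  shows "act \<nu> (a * b) x = act \<nu> a (act \<nu> b x)"
proof
  fix S
  have "(\<Sum>T\<in>M \<nu>. (\<Sum>Y\<in>M \<nu>. coef \<nu> a S Y * coef \<nu> b Y T) * x T) =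
      (\<Sum>Y\<in>M \<nu>. coef \<nu> a S Y * (\<Sum>T\<in>M \<nu>. coef \<nu> b Y T * x T))"
    unfolding sum_distrib_left sum_distrib_right by (subst sum.swap) (simp add: mult.assoc)
  then show "act \<nu> (a * b) x S = act \<nu> a (act \<nu> b x) S"
    using assms by (simp add: act_def coef_mult)
qed

lemma act_lower: "x \<in> low \<nu> \<Longrightarrow> \<nu> \<in> \<Lambda> \<Longrightarrow> act \<nu> x v S = 0"
  by (simp add: act_def coef_lower_eq_0)

text \<open>
  Modulo elements that act as zero, \<open>C \<nu> U V * b\<close> is again a combination of the \<open>C \<nu> U T\<close>.
\<close>

lemma act_form_radical:
  assumes "\<nu> \<in> \<Lambda>" "x \<in> form_radical \<nu>"
  shows "act \<nu> b x \<in> form_radical \<nu>"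
proof -
  have "act \<nu> (C \<nu> U V) (act \<nu> b x) X = 0" if "U \<in> M \<nu>" "V \<in> M \<nu>" for U V X
  proof -
    have "act \<nu> (C \<nu> U V * b - (\<Sum>T'\<in>M \<nu>. coef \<nu> (star b) T' V *s C \<nu> U T')) x X = 0"
      using that assms by (intro act_lower C_mult)
    then have "act \<nu> (C \<nu> U V * b) x X = 0"
      using that assms by (simp add: act_diff act_sum act_scale form_radical_def)
    then show ?thesis using assms by (simp add: act_mult)
  qed
  then show ?thesis by (auto simp: form_radical_def act_def[of \<nu> b])
qed

end

section \<open>The action of the Jucys-Murphy elements\<close>

context jucys_murphy
begin

text \<open>
  The defining congruence describes right multiplication by \<open>L i\<close>; as \<open>star\<close> fixes \<open>L i\<close>, it also
  gives the matrix of \<open>L i\<close> on the left cell module.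
\<close>

lemma
  assumes \<nu>: "\<nu> \<in> \<Lambda>" and T: "T \<in> M \<nu>" and i: "i \<in> {1..m}"
  shows coef_L_diag: "coef \<nu> (L i) T T = c \<nu> T i"
    and coef_L_triangular: "V \<in> M \<nu> \<Longrightarrow> V \<noteq> T \<Longrightarrow> \<not> leM \<nu> V T \<Longrightarrow> coef \<nu> (L i) V T = 0"
proof -
  let ?D = "{W \<in> M \<nu>. leM \<nu> W T \<and> W \<noteq> T}"
  have coef_eq: "coef \<nu> (L i) V T = c \<nu> T i * (if T = V then 1 else 0)
      + (\<Sum>W\<in>?D. coef \<nu> (L i) W T * (if W = V then 1 else 0))" if V: "V \<in> M \<nu>" for V
  proof -
    have "coord \<nu> T V (C \<nu> T T * L i
          - (c \<nu> T i *s C \<nu> T T + (\<Sum>W\<in>?D. coef \<nu> (L i) W T *s C \<nu> T W))) = 0"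
      by (rule coord_lower[OF C_mult_L]) (use assms V in auto)
    then show ?thesis
      using assms V
      by (simp add: coord_diff coord_add coord_sum coord_scale coord_C coord_C_mult star_L)
  qed
  show "coef \<nu> (L i) T T = c \<nu> T i"
    by (subst coef_eq[OF T]) (auto intro!: sum.neutral)
  show "coef \<nu> (L i) V T = 0" if "V \<in> M \<nu>" "V \<noteq> T" "\<not> leM \<nu> V T"
    by (subst coef_eq) (use that in \<open>auto intro!: sum.neutral\<close>)
qed

text \<open>
  If \<open>S\<close> is maximal in a down-closed set that supports \<open>x\<close>, triangularity makes
  \<open>L i - c \<nu> S i\<close> erase the entry of \<open>x\<close> at \<open>S\<close> without leaving that set.  For a supporting
  set of least size the result is zero, for every \<open>i\<close> at once.
\<close>

lemma joint_eigenvector: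
  assumes \<nu>: "\<nu> \<in> \<Lambda>" and supp: "\<And>x T. x \<in> N \<Longrightarrow> T \<notin> M \<nu> \<Longrightarrow> x T = 0"
    and closed: "\<And>x a. x \<in> N \<Longrightarrow> act \<nu> a x \<in> N" and nontrivial: "\<exists>x\<in>N. x \<noteq> (\<lambda>_. 0)"
  obtains v S where "v \<in> N" "v \<noteq> (\<lambda>_. 0)" "S \<in> M \<nu>"
    "\<And>i. i \<in> {1..m} \<Longrightarrow> act \<nu> (L i) v = (\<lambda>T. c \<nu> S i * v T)"
proof -
  define good where "good D \<longleftrightarrow> D \<subseteq> M \<nu> \<and> (\<forall>T\<in>D. \<forall>V\<in>M \<nu>. leM \<nu> V T \<longrightarrow> V \<in> D) \<and>
    (\<exists>x\<in>N. x \<noteq> (\<lambda>_. 0) \<and> (\<forall>T. T \<notin> D \<longrightarrow> x T = 0))" for D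
  have "good (M \<nu>)" unfolding good_def using nontrivial supp by blast
  then obtain D where D: "good D" and D_min: "\<And>E. good E \<Longrightarrow> card D \<le> card E"
    using ex_has_least_nat[of good "M \<nu>" card] by blast
  from D obtain x where x: "x \<in> N" "x \<noteq> (\<lambda>_. 0)" "\<And>T. T \<notin> D \<Longrightarrow> x T = 0"
    and DM: "D \<subseteq> M \<nu>" and down: "\<And>T V. T \<in> D \<Longrightarrow> V \<in> M \<nu> \<Longrightarrow> leM \<nu> V T \<Longrightarrow> V \<in> D"
    unfolding good_def by blast
  have "D \<noteq> {}" using x by auto
  then obtain S where S: "S \<in> D" "\<And>T. T \<in> D \<Longrightarrow> leM \<nu> S T \<Longrightarrow> T = S"
    using finite_maximal[OF M_order[OF \<nu>] finite_M[OF \<nu>] DM] by blast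
  have finD: "finite D" using finite_M \<nu> DM finite_subset by blast
  have "act \<nu> (L i) x = (\<lambda>T. c \<nu> S i * x T)" if i: "i \<in> {1..m}" for i
  proof -
    define y where "y = act \<nu> (L i - c \<nu> S i *s 1) x"
    have "y V = 0" if "V \<notin> D - {S}" for V
    proof (cases "V \<in> M \<nu>")
      case True
      have "coef \<nu> (L i - c \<nu> S i *s 1) V T * x T = 0" if T: "T \<in> M \<nu>" for T
      proof (cases "T \<in> D")
        case TD: True
        show ?thesis
        proof (cases "V = T")
          case True
          then have "V = S" using \<open>V \<notin> D - {S}\<close> TD by blast
          with True show ?thesis using \<nu> T i by (simp add: coef_diff coef_scale coef_one coef_L_diag)
        next
          case False
          have "\<not> leM \<nu> V T"
            using S TD False \<open>V \<notin> D - {S}\<close> \<open>V \<in> M \<nu>\<close> down by blast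
          then show ?thesis
            using \<nu> T i False True by (simp add: coef_diff coef_scale coef_one coef_L_triangular)
        qed
      qed (simp add: x)
      then show ?thesis by (simp add: y_def act_def)
    qed (simp add: y_def act_def)
    moreover have "y \<in> N" unfolding y_def using closed x by blast
    moreover have "\<not> good (D - {S})"
      using D_min[of "D - {S}"] S(1) finD by (metis card_Diff1_less leD)
    moreover have "\<forall>T\<in>D - {S}. \<forall>V\<in>M \<nu>. leM \<nu> V T \<longrightarrow> V \<in> D - {S}"
      using down S by blast
    ultimately have "y = (\<lambda>_. 0)"
      unfolding good_def using DM by blast
    then have "act \<nu> (L i) x T - c \<nu> S i * act \<nu> 1 x T = 0" for T
      using \<nu> by (metis y_def act_diff act_scale)
    moreover have "act \<nu> 1 x = x" using act_one \<nu> supp x by blast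
    ultimately show ?thesis by auto
  qed
  with x S DM show thesis using that by blast
qed

definition triangular_on :: "'l \<Rightarrow> 'a \<Rightarrow> bool" where
  "triangular_on \<nu> a \<longleftrightarrow> (\<forall>V\<in>M \<nu>. \<forall>T\<in>M \<nu>. coef \<nu> a V T \<noteq> 0 \<longrightarrow> leM \<nu> V T)"

lemma triangular_one:
  assumes "\<nu> \<in> \<Lambda>"
  shows "triangular_on \<nu> 1"
  using M_order[OF assms] assms
  by (auto simp: triangular_on_def coef_one partial_orderp_on_def reflp_on_def)

lemma triangular_L:
  assumes "\<nu> \<in> \<Lambda>" "i \<in> {1..m}"
  shows "triangular_on \<nu> (L i)"
  unfolding triangular_on_def
proof (intro ballI impI)
  fix V T assume *: "V \<in> M \<nu>" "T \<in> M \<nu>" "coef \<nu> (L i) V T \<noteq> 0"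
  then have "V = T \<or> leM \<nu> V T" using coef_L_triangular[OF assms(1) _ assms(2)] by blast
  then show "leM \<nu> V T"
    using M_order[OF assms(1)] * by (auto simp: partial_orderp_on_def dest: reflp_onD)
qed

text \<open>
  The diagonal of a product of triangular matrices is the product of the diagonals: an
  off-diagonal contribution to the entry at \<open>(T, T)\<close> would need \<open>T < Y < T\<close>.
\<close>

lemma triangular_mult:
  assumes \<nu>: "\<nu> \<in> \<Lambda>" and a: "triangular_on \<nu> a" and b: "triangular_on \<nu> b"
  shows "triangular_on \<nu> (a * b)"
    and "T \<in> M \<nu> \<Longrightarrow> coef \<nu> (a * b) T T = coef \<nu> a T T * coef \<nu> b T T"
proof -
  note order = M_order[OF \<nu>, unfolded partial_orderp_on_def]
  show "triangular_on \<nu> (a * b)"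
    unfolding triangular_on_def
  proof (intro ballI impI)
    fix V T assume *: "V \<in> M \<nu>" "T \<in> M \<nu>" "coef \<nu> (a * b) V T \<noteq> 0"
    then have "(\<Sum>Y\<in>M \<nu>. coef \<nu> a V Y * coef \<nu> b Y T) \<noteq> 0" using \<nu> by (simp add: coef_mult)
    then obtain Y where "Y \<in> M \<nu>" "coef \<nu> a V Y * coef \<nu> b Y T \<noteq> 0"
      by (rule sum.not_neutral_contains_not_neutral)
    moreover from this have "coef \<nu> a V Y \<noteq> 0" "coef \<nu> b Y T \<noteq> 0" by auto
    ultimately have "leM \<nu> V Y" "leM \<nu> Y T" "Y \<in> M \<nu>"
      using a b * unfolding triangular_on_def by blast+
    then show "leM \<nu> V T" using order * by (blast dest: transp_onD)
  qed
  assume T: "T \<in> M \<nu>"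
  have "coef \<nu> a T Y * coef \<nu> b Y T = 0" if "Y \<in> M \<nu>" "Y \<noteq> T" for Y
  proof (rule ccontr)
    assume "coef \<nu> a T Y * coef \<nu> b Y T \<noteq> 0"
    then have "coef \<nu> a T Y \<noteq> 0" "coef \<nu> b Y T \<noteq> 0" by auto
    then have "leM \<nu> T Y" "leM \<nu> Y T" using a b T that unfolding triangular_on_def by blast+
    then show False using order T that by (blast dest: antisymp_onD)
  qed
  then show "coef \<nu> (a * b) T T = coef \<nu> a T T * coef \<nu> b T T"
    using \<nu> T finite_M by (simp add: coef_mult sum.remove)
qed

lemma triangular_power:
  assumes "\<nu> \<in> \<Lambda>" "triangular_on \<nu> a"
  shows "triangular_on \<nu> (a ^ k)"
    and "T \<in> M \<nu> \<Longrightarrow> coef \<nu> (a ^ k) T T = coef \<nu> a T T ^ k"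
  using assms by (induction k) (simp_all add: triangular_one triangular_mult coef_one)

lemma triangular_prod_list:
  assumes "\<nu> \<in> \<Lambda>" "\<And>i. i \<in> set is \<Longrightarrow> triangular_on \<nu> (f i)"
  shows "triangular_on \<nu> (\<Prod>i\<leftarrow>is. f i)"
    and "T \<in> M \<nu> \<Longrightarrow> coef \<nu> (\<Prod>i\<leftarrow>is. f i) T T = (\<Prod>i\<leftarrow>is. coef \<nu> (f i) T T)"
  using assms by (induction "is") (simp_all add: triangular_one triangular_mult coef_one)

lemma coef_poly_at_L:
  assumes "\<nu> \<in> \<Lambda>" "T \<in> M \<nu>"
  shows "coef \<nu> (poly_at scale m L p) T T = poly_at (*) m (c \<nu> T) p"
proof -
  have "coef \<nu> (\<Prod>i\<leftarrow>[1..<Suc m]. L i ^ k i) T T = (\<Prod>i\<leftarrow>[1..<Suc m]. c \<nu> T i ^ k i)" for k :: "nat \<Rightarrow> nat"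
  proof -
    have "coef \<nu> (\<Prod>i\<leftarrow>[1..<Suc m]. L i ^ k i) T T = (\<Prod>i\<leftarrow>[1..<Suc m]. coef \<nu> (L i ^ k i) T T)"
      by (rule triangular_prod_list(2))
        (use assms in \<open>auto intro!: triangular_power triangular_L\<close>)
    also have "\<dots> = (\<Prod>i\<leftarrow>[1..<Suc m]. c \<nu> T i ^ k i)"
      by (intro arg_cong[where f = prod_list] map_cong refl)
        (use assms in \<open>auto simp: triangular_power triangular_L coef_L_diag\<close>)
    finally show ?thesis .
  qed
  then show ?thesis
    using assms unfolding poly_at_def by (simp add: coef_sum coef_scale del: upt_Suc)
qed

end

section \<open>Separation and faithfulness of the cell modules\<close>

locale separated_jucys_murphy = jucys_murphy scale \<Lambda> le M C star coef leM m L c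
  for scale :: "'r::idom \<Rightarrow> 'a::{ring,monoid_mult} \<Rightarrow> 'a" (infixr \<open>*s\<close> 75)
    and \<Lambda> :: "'l set" and le and M :: "'l \<Rightarrow> 't set" and C and star and coef and leM
    and m and L :: "nat \<Rightarrow> 'a" and c +
  assumes separated: "\<kappa> \<in> \<Lambda> \<Longrightarrow> \<nu> \<in> \<Lambda> \<Longrightarrow> le \<kappa> \<nu> \<Longrightarrow> \<kappa> \<noteq> \<nu> \<Longrightarrow> S \<in> M \<kappa> \<Longrightarrow> T \<in> M \<nu> \<Longrightarrow>
    \<exists>i\<in>{1..m}. c \<kappa> S i \<noteq> c \<nu> T i"
begin

text \<open>
  The eigenvalues of a joint eigenvector \<open>v\<close> in a nonzero radical would also be the contents of a
  tableau of a larger shape: for \<open>\<mu>\<close> minimal with \<open>C \<mu> U T\<close> not killing \<open>v\<close>, the lower shapes annihilate \<open>v\<close>, so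
  \<open>C \<mu> U T \<mapsto> C \<mu> U T v\<close> respects the triangular action of the \<open>L i\<close> from the right.
\<close>

lemma form_radical_trivial:
  assumes \<nu>: "\<nu> \<in> \<Lambda>" and x: "x \<in> form_radical \<nu>"
  shows "x = (\<lambda>_. 0)"
proof (rule ccontr)
  assume "x \<noteq> (\<lambda>_. 0)"
  then have ex: "\<exists>x\<in>form_radical \<nu>. x \<noteq> (\<lambda>_. 0)" using x by blast
  have supp: "\<And>x T. x \<in> form_radical \<nu> \<Longrightarrow> T \<notin> M \<nu> \<Longrightarrow> x T = 0"
    unfolding form_radical_def by blast
  obtain v S where v: "v \<in> form_radical \<nu>" "v \<noteq> (\<lambda>_. 0)" and S: "S \<in> M \<nu>"
    and eigen: "\<And>i. i \<in> {1..m} \<Longrightarrow> act \<nu> (L i) v = (\<lambda>T. c \<nu> S i * v T)"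
    by (rule joint_eigenvector[OF \<nu> _ _ ex])
      (erule (1) supp, erule act_form_radical[OF \<nu>], rule that)
  define X where "X = {\<mu> \<in> \<Lambda>. \<exists>U\<in>M \<mu>. \<exists>T\<in>M \<mu>. act \<nu> (C \<mu> U T) v \<noteq> (\<lambda>_. 0)}"
  have "X \<noteq> {}"
  proof
    assume "X = {}"
    then have zero: "act \<nu> (C \<mu> U T) v Y = 0" if "\<mu> \<in> \<Lambda>" "U \<in> M \<mu>" "T \<in> M \<mu>" for \<mu> U T Y
      using that unfolding X_def by (metis (mono_tags, lifting) empty_Collect_eq)
    have "act \<nu> 1 v Y = 0" for Y
      by (subst coord_expand[of 1]) (auto simp: act_sum act_scale \<nu> zero case_prod_unfold intro!: sum.neutral)
    moreover have "act \<nu> 1 v = v"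
      using act_one \<nu> v(1) unfolding form_radical_def by blast
    ultimately show False using v(2) by auto
  qed
  moreover have "X \<subseteq> \<Lambda>" by (auto simp: X_def)
  ultimately obtain \<mu> where \<mu>: "\<mu> \<in> X" and \<mu>_min: "\<And>\<kappa>. \<kappa> \<in> X \<Longrightarrow> le \<kappa> \<mu> \<Longrightarrow> \<kappa> = \<mu>"
    using finite_minimal[OF shapes_order finite_shapes, of X] by metis
  from \<mu> obtain U T0 where U: "\<mu> \<in> \<Lambda>" "U \<in> M \<mu>" and T0: "T0 \<in> M \<mu>" "act \<nu> (C \<mu> U T0) v \<noteq> (\<lambda>_. 0)"
    unfolding X_def by blast
  have "le \<nu> \<mu>"
  proof (rule ccontr)
    assume "\<not> le \<nu> \<mu>"
    then have "act \<nu> (C \<mu> U T0) v = (\<lambda>_. 0)"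
      using T0(1) U \<nu> by (intro ext) (simp add: act_def coef_C_eq_0)
    with T0(2) show False by blast
  qed
  have "\<nu> \<noteq> \<mu>" using T0 U v(1) unfolding form_radical_def by blast
  let ?N = "{V \<in> M \<mu>. act \<nu> (C \<mu> U V) v \<noteq> (\<lambda>_. 0)}"
  obtain T where "T \<in> ?N" and T_min': "\<And>V. V \<in> ?N \<Longrightarrow> leM \<mu> V T \<Longrightarrow> V = T"
    by (rule finite_minimal[OF M_order[OF U(1)] finite_M[OF U(1)], of ?N]) (use T0 in auto)
  then have T: "T \<in> M \<mu>" "act \<nu> (C \<mu> U T) v \<noteq> (\<lambda>_. 0)" by auto
  have T_min: "act \<nu> (C \<mu> U V) v = (\<lambda>_. 0)" if "V \<in> M \<mu>" "leM \<mu> V T" "V \<noteq> T" for V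
    using T_min'[of V] that by blast
  have low0: "act \<nu> y v Y = 0" if "y \<in> low \<mu>" for y Y
    using that
  proof (induction rule: lower_induct)
    case (C r \<kappa> P Q)
    then have "act \<nu> (C \<kappa> P Q) v = (\<lambda>_. 0)" using \<mu>_min unfolding X_def by blast
    then show ?case using \<nu> by (simp add: act_scale)
  qed (simp_all add: \<nu> act_zero act_add)
  obtain Y where Y: "act \<nu> (C \<mu> U T) v Y \<noteq> 0" using T by auto
  have "c \<nu> S i = c \<mu> T i" if i: "i \<in> {1..m}" for i
  proof -
    let ?D = "{V \<in> M \<mu>. leM \<mu> V T \<and> V \<noteq> T}"
    have "act \<nu> (C \<mu> U T * L i
        - (c \<mu> T i *s C \<mu> U T + (\<Sum>V\<in>?D. coef \<mu> (L i) V T *s C \<mu> U V))) v Y = 0"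
      by (rule low0[OF C_mult_L]) (use U T i in auto)
    moreover have "(\<Sum>V\<in>?D. act \<nu> (coef \<mu> (L i) V T *s C \<mu> U V) v Y) = 0"
    proof (rule sum.neutral, rule ballI)
      fix V assume "V \<in> ?D"
      then have "act \<nu> (C \<mu> U V) v = (\<lambda>_. 0)" using T_min by blast
      then show "act \<nu> (coef \<mu> (L i) V T *s C \<mu> U V) v Y = 0" using \<nu> by (simp add: act_scale)
    qed
    ultimately have "c \<nu> S i * act \<nu> (C \<mu> U T) v Y = c \<mu> T i * act \<nu> (C \<mu> U T) v Y"
      using \<nu> i by (simp add: act_diff act_add act_scale act_sum act_mult eigen act_smult)
    with Y show ?thesis by simp
  qed
  with separated[OF \<nu> U(1) \<open>le \<nu> \<mu>\<close> \<open>\<nu> \<noteq> \<mu>\<close> S T(1)] show False by blast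
qed

text \<open>
  Take a shape \<open>\<nu>\<close> that is maximal among those occurring in \<open>a\<close>.  On its cell module only the
  terms of shape \<open>\<nu>\<close> act, and their action being zero says that each row of coordinates
  of shape \<open>\<nu>\<close> lies in the radical of the form.
\<close>

lemma cell_modules_faithful:
  assumes zero: "\<And>\<kappa> S T. \<kappa> \<in> \<Lambda> \<Longrightarrow> S \<in> M \<kappa> \<Longrightarrow> T \<in> M \<kappa> \<Longrightarrow> coef \<kappa> a S T = 0"
  shows "a = 0"
proof (rule ccontr)
  assume "a \<noteq> 0"
  define X where "X = {\<kappa> \<in> \<Lambda>. \<exists>S\<in>M \<kappa>. \<exists>T\<in>M \<kappa>. coord \<kappa> S T a \<noteq> 0}"
  have "X \<noteq> {}" using \<open>a \<noteq> 0\<close> coord_eqI[of a 0] by (auto simp: X_def coord_zero)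
  moreover have "X \<subseteq> \<Lambda>" by (auto simp: X_def)
  ultimately obtain \<nu> where "\<nu> \<in> X" and \<nu>_max: "\<And>\<kappa>. \<kappa> \<in> X \<Longrightarrow> le \<nu> \<kappa> \<Longrightarrow> \<kappa> = \<nu>"
    using finite_maximal[OF shapes_order finite_shapes, of X] by metis
  from \<open>\<nu> \<in> X\<close> obtain S0 T0 where \<nu>: "\<nu> \<in> \<Lambda>" and S0: "S0 \<in> M \<nu>" and T0: "T0 \<in> M \<nu>" "coord \<nu> S0 T0 a \<noteq> 0"
    unfolding X_def by blast
  define x where "x T = (if T \<in> M \<nu> then coord \<nu> S0 T a else 0)" for T
  have pairing: "(\<Sum>T\<in>M \<nu>. coef \<nu> (C \<nu> S0 T) S0 V * x T) = 0" if V: "V \<in> M \<nu>" for V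
  proof -
    let ?I = "SIGMA \<kappa>:\<Lambda>. M \<kappa> \<times> M \<kappa>"
    let ?t = "\<lambda>(\<kappa>, S, T). coord \<kappa> S T a * coef \<nu> (C \<kappa> S T) S0 V"
    have "0 = coef \<nu> (\<Sum>(\<kappa>, S, T)\<in>?I. coord \<kappa> S T a *s C \<kappa> S T) S0 V"
      using zero[OF \<nu> S0 V] coord_expand[of a] by simp
    also have "\<dots> = sum ?t ?I"
      using \<nu> S0 V by (simp add: coef_sum coef_scale case_prod_unfold)
    \<comment> \<open>Other shapes act as zero by maximality of \<open>\<nu>\<close>; the other rows of \<open>\<nu>\<close> do not reach the entry at \<open>S0\<close>.\<close>
    also have "\<dots> = sum ?t ((\<lambda>T. (\<nu>, S0, T)) ` M \<nu>)"
    proof (rule sum.mono_neutral_right)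
      show "finite ?I" by (rule finite_index)
      show "(\<lambda>T. (\<nu>, S0, T)) ` M \<nu> \<subseteq> ?I" using \<nu> S0 by auto
      show "\<forall>i\<in>?I - (\<lambda>T. (\<nu>, S0, T)) ` M \<nu>. ?t i = 0"
      proof clarify
        fix \<kappa> S T
        assume *: "\<kappa> \<in> \<Lambda>" "S \<in> M \<kappa>" "T \<in> M \<kappa>" "(\<kappa>, S, T) \<notin> (\<lambda>T. (\<nu>, S0, T)) ` M \<nu>"
        show "coord \<kappa> S T a * coef \<nu> (C \<kappa> S T) S0 V = 0"
        proof (cases "\<kappa> = \<nu>")
          case True
          then have "S \<noteq> S0" using * by auto
          then show ?thesis using True * \<nu> S0 V coef_C[of \<nu> S T S0 V V] by simp
        next
          case False
          then have "\<not> le \<nu> \<kappa> \<or> coord \<kappa> S T a = 0"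
            using \<nu>_max * unfolding X_def by blast
          then show ?thesis using * \<nu> S0 V by (auto simp: coef_C_eq_0)
        qed
      qed
    qed
    also have "\<dots> = (\<Sum>T\<in>M \<nu>. coef \<nu> (C \<nu> S0 T) S0 V * x T)"
      by (subst sum.reindex) (auto simp: inj_on_def x_def mult.commute intro!: sum.cong)
    finally show ?thesis by simp
  qed
  have "act \<nu> (C \<nu> U V) x Y = 0" if "U \<in> M \<nu>" "V \<in> M \<nu>" for U V Y
  proof (cases "Y \<in> M \<nu>")
    case True
    then have "coef \<nu> (C \<nu> U V) Y T = (if Y = U then coef \<nu> (C \<nu> S0 T) S0 V else 0)" if "T \<in> M \<nu>" for T
      using coef_C[of \<nu> U V Y T S0] that \<nu> S0 \<open>U \<in> M \<nu>\<close> \<open>V \<in> M \<nu>\<close> by simp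
    then show ?thesis using pairing[of V] that True by (cases "Y = U") (simp_all add: act_def)
  qed (simp add: act_def)
  then have "x \<in> form_radical \<nu>" by (auto simp: form_radical_def x_def)
  then have "x T0 = 0" using form_radical_trivial[OF \<nu>, of x] by simp
  with T0 show False by (simp add: x_def)
qed

text \<open>
  There is one unknown for each basis element and one more, \<open>None\<close>, for the target \<open>e\<close>,
  which has the identity matrix at \<open>\<nu>\<close> and zero matrices elsewhere; there is one equation for each
  matrix entry, so one unknown more than equations.  Faithfulness forces the coefficient of the target in a
  nontrivial solution to be nonzero.
\<close>

lemma scaled_cell_block_unit:
  assumes "\<nu> \<in> \<Lambda>"
  obtains z d where "d \<noteq> 0" "\<And>\<kappa> S T. \<kappa> \<in> \<Lambda> \<Longrightarrow> S \<in> M \<kappa> \<Longrightarrow> T \<in> M \<kappa> \<Longrightarrow>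
    coef \<kappa> z S T = (if \<kappa> = \<nu> \<and> S = T then d else 0)"
proof -
  let ?I = "SIGMA \<kappa>:\<Lambda>. M \<kappa> \<times> M \<kappa>"
  define e :: "'l \<times> 't \<times> 't \<Rightarrow> 'r"
    where "e = (\<lambda>(\<kappa>, S, T). if \<kappa> = \<nu> \<and> S = T then 1 else 0)"
  define f where "f i = (\<lambda>(\<kappa>, S, T). case i of None \<Rightarrow> e (\<kappa>, S, T)
      | Some (\<rho>, U, V) \<Rightarrow> coef \<kappa> (C \<rho> U V) S T)" for i
  obtain a where a: "\<And>j. j \<in> ?I \<Longrightarrow> (\<Sum>i\<in>insert None (Some ` ?I). a i * f i j) = 0"
    and a_nz: "\<exists>i\<in>insert None (Some ` ?I). a i \<noteq> 0"
    by (rule more_unknowns_than_equations[of ?I "insert None (Some ` ?I)" f])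
      (use finite_index in \<open>auto simp: card_image\<close>)
  define z where "z = (\<Sum>(\<rho>, U, V)\<in>?I. a (Some (\<rho>, U, V)) *s C \<rho> U V)"
  have coef_z: "coef \<kappa> z S T = (if \<kappa> = \<nu> \<and> S = T then - a None else 0)"
    if "\<kappa> \<in> \<Lambda>" "S \<in> M \<kappa>" "T \<in> M \<kappa>" for \<kappa> S T
  proof -
    have "coef \<kappa> z S T = (\<Sum>i\<in>Some ` ?I. a i * f i (\<kappa>, S, T))"
      using that by (subst sum.reindex)
        (simp_all add: z_def coef_sum coef_scale f_def case_prod_unfold)
    moreover have "a None * e (\<kappa>, S, T) + (\<Sum>i\<in>Some ` ?I. a i * f i (\<kappa>, S, T)) = 0"
      using a[of "(\<kappa>, S, T)"] that finite_index by (simp add: f_def)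
    ultimately show ?thesis by (auto simp: e_def add_eq_0_iff)
  qed
  have "a None \<noteq> 0"
  proof
    assume None: "a None = 0"
    then have "z = 0" using cell_modules_faithful[of z] coef_z by simp
    have "a (Some (\<kappa>, S, T)) = 0" if "\<kappa> \<in> \<Lambda>" "S \<in> M \<kappa>" "T \<in> M \<kappa>" for \<kappa> S T
    proof -
      have "coord \<kappa> S T z = (\<Sum>i\<in>?I. if i = (\<kappa>, S, T) then a (Some i) else 0)"
        unfolding z_def coord_sum using that
        by (intro sum.cong) (auto simp: coord_scale coord_C split: if_splits)
      then show ?thesis using \<open>z = 0\<close> that finite_index by (simp add: coord_zero)
    qed
    with None a_nz show False by auto
  qed
  then show thesis using that[of "- a None" z] coef_z by simp
qed

lemma central_if_scalar_on_cell_modules: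
  assumes "\<And>\<kappa> S T. \<kappa> \<in> \<Lambda> \<Longrightarrow> S \<in> M \<kappa> \<Longrightarrow> T \<in> M \<kappa> \<Longrightarrow> coef \<kappa> z S T = (if S = T then w \<kappa> else 0)"
  shows "z \<in> ring_center"
proof -
  have "z * a - a * z = 0" for a
  proof (rule cell_modules_faithful)
    fix \<kappa> S T assume *: "\<kappa> \<in> \<Lambda>" "S \<in> M \<kappa>" "T \<in> M \<kappa>"
    have "(\<Sum>Y\<in>M \<kappa>. coef \<kappa> z S Y * coef \<kappa> a Y T) = (\<Sum>Y\<in>M \<kappa>. if Y = S then w \<kappa> * coef \<kappa> a Y T else 0)"
      "(\<Sum>Y\<in>M \<kappa>. coef \<kappa> a S Y * coef \<kappa> z Y T) = (\<Sum>Y\<in>M \<kappa>. if Y = T then w \<kappa> * coef \<kappa> a S Y else 0)"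
      by (rule sum.cong; use * assms in auto)+
    then show "coef \<kappa> (z * a - a * z) S T = 0"
      using * finite_M by (simp add: coef_diff coef_mult)
  qed
  then show ?thesis by (simp add: ring_center_def)
qed

end

section \<open>Symmetric polynomials and contents\<close>

text \<open>
  Permuting the values amounts to permuting the exponents of each monomial, and the
  coefficients of a symmetric polynomial are invariant under the latter.
\<close>

lemma poly_at_symmetric:
  fixes f g :: "nat \<Rightarrow> 'r::comm_ring_1"
  assumes p: "p \<in> symmetric_polys m" and \<sigma>: "\<sigma> permutes {1..m}"
    and fg: "\<And>i. i \<in> {1..m} \<Longrightarrow> f i = g (\<sigma> i)"
  shows "poly_at (*) m f p = poly_at (*) m g p"
proof -
  let ?h = "Poly_Mapping.map_key \<sigma>" and ?h' = "Poly_Mapping.map_key (inv \<sigma>)"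
  have inj: "inj \<sigma>" "inj (inv \<sigma>)"
    using \<sigma> permutes_inv[OF \<sigma>] permutes_inj by blast+
  have h: "Poly_Mapping.lookup (?h e) i = Poly_Mapping.lookup e (\<sigma> i)" for e :: "nat \<Rightarrow>\<^sub>0 nat" and i
    using inj by (simp add: map_key.rep_eq)
  have h': "Poly_Mapping.lookup (?h' e) i = Poly_Mapping.lookup e (inv \<sigma> i)" for e :: "nat \<Rightarrow>\<^sub>0 nat" and i
    using inj by (simp add: map_key.rep_eq)
  have list: "(\<Prod>i\<leftarrow>[1..<Suc m]. k i) = (\<Prod>i\<in>{1..m}. k i)" for k :: "nat \<Rightarrow> 'r"
    using prod.distinct_set_conv_list[of "[1..<Suc m]" k] by (simp add: atLeastLessThanSuc_atLeastAtMost del: upt_Suc)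
  have coeff: "Poly_Mapping.lookup p (?h e) = Poly_Mapping.lookup p e"
      "Poly_Mapping.lookup p (?h' e) = Poly_Mapping.lookup p e" for e
    using p \<sigma> permutes_inv[OF \<sigma>] by (auto simp: symmetric_polys_def)
  have keys: "?h e \<in> Poly_Mapping.keys p" "?h' e \<in> Poly_Mapping.keys p"
    if "e \<in> Poly_Mapping.keys p" for e
    using that coeff by (auto simp: in_keys_iff)
  show ?thesis
    unfolding poly_at_def list
  proof (rule sum.reindex_bij_witness[where i = ?h and j = ?h'])
    fix e assume "e \<in> Poly_Mapping.keys p"
    show "?h (?h' e) = e" "?h' (?h e) = e"
      using \<sigma> by (auto intro!: poly_mapping_eqI simp: h h' permutes_inverses)
    have "(\<Prod>i\<in>{1..m}. f i ^ Poly_Mapping.lookup e i)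
        = (\<Prod>i\<in>{1..m}. g (\<sigma> i) ^ Poly_Mapping.lookup (?h' e) (\<sigma> i))"
      by (rule prod.cong) (use \<sigma> in \<open>auto simp: fg h' permutes_inverses\<close>)
    also have "\<dots> = (\<Prod>i\<in>{1..m}. g i ^ Poly_Mapping.lookup (?h' e) i)"
      using prod.permute[OF \<sigma>, of "\<lambda>i. g i ^ Poly_Mapping.lookup (?h' e) i"] by (simp add: o_def)
    finally show "Poly_Mapping.lookup p (?h' e) * (\<Prod>i\<in>{1..m}. g i ^ Poly_Mapping.lookup (?h' e) i)
        = Poly_Mapping.lookup p e * (\<Prod>i\<in>{1..m}. f i ^ Poly_Mapping.lookup e i)"
      by (simp add: coeff)
  qed (use keys in auto)
qed

theorem corollary3p6:
  fixes scale :: "'r::idom \<Rightarrow> 'a::{ring,monoid_mult} \<Rightarrow> 'a"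
    and \<Lambda> :: "'l set" and le :: "'l \<Rightarrow> 'l \<Rightarrow> bool"
    and M :: "'l \<Rightarrow> 't set" and C :: "'l \<Rightarrow> 't \<Rightarrow> 't \<Rightarrow> 'a"
    and star :: "'a \<Rightarrow> 'a" and coef :: "'l \<Rightarrow> 'a \<Rightarrow> 't \<Rightarrow> 't \<Rightarrow> 'r"
    and leM :: "'l \<Rightarrow> 't \<Rightarrow> 't \<Rightarrow> bool"
    and m :: nat and L :: "nat \<Rightarrow> 'a" and c :: "'l \<Rightarrow> 't \<Rightarrow> nat \<Rightarrow> 'r"
    and \<nu> \<mu> :: 'l and S T :: 't
  assumes "jucys_murphy scale \<Lambda> le M C star coef leM m L c"
    and "separation_condition \<Lambda> le M leM m c"
    and "(ring_center :: 'a set) = {poly_at scale m L p | p. p \<in> symmetric_polys m}"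
    and "\<nu> \<in> \<Lambda>" and "\<mu> \<in> \<Lambda>" and "\<nu> \<noteq> \<mu>"
    and "S \<in> M \<nu>" and "T \<in> M \<mu>"
  shows "\<not> (\<exists>\<sigma>. \<sigma> permutes {1..m} \<and> (\<forall>i\<in>{1..m}. c \<nu> S i = c \<mu> T (\<sigma> i)))"
proof
  assume "\<exists>\<sigma>. \<sigma> permutes {1..m} \<and> (\<forall>i\<in>{1..m}. c \<nu> S i = c \<mu> T (\<sigma> i))"
  then obtain \<sigma> where \<sigma>: "\<sigma> permutes {1..m}" "\<And>i. i \<in> {1..m} \<Longrightarrow> c \<nu> S i = c \<mu> T (\<sigma> i)"
    by blast
  interpret jucys_murphy scale \<Lambda> le M C star coef leM m L c by fact
  interpret separated_jucys_murphy scale \<Lambda> le M C star coef leM m L c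
  proof
    fix \<kappa> \<rho> U V
    assume *: "\<kappa> \<in> \<Lambda>" "\<rho> \<in> \<Lambda>" "le \<kappa> \<rho>" "\<kappa> \<noteq> \<rho>" "U \<in> M \<kappa>" "V \<in> M \<rho>"
    then have "(\<kappa>, U) \<in> Sigma \<Lambda> M" "(\<rho>, V) \<in> Sigma \<Lambda> M" "tableau_le le leM (\<kappa>, U) (\<rho>, V)"
      by (auto simp: tableau_le_def)
    then show "\<exists>i\<in>{1..m}. c \<kappa> U i \<noteq> c \<rho> V i"
      using assms(2) * unfolding separation_condition_def by blast
  qed
  obtain z d where "d \<noteq> 0" and z: "\<And>\<kappa> S T. \<kappa> \<in> \<Lambda> \<Longrightarrow> S \<in> M \<kappa> \<Longrightarrow> T \<in> M \<kappa> \<Longrightarrow>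
      coef \<kappa> z S T = (if \<kappa> = \<nu> \<and> S = T then d else 0)"
    by (rule scaled_cell_block_unit[OF \<open>\<nu> \<in> \<Lambda>\<close>]) (rule that)
  have "z \<in> ring_center"
    by (rule central_if_scalar_on_cell_modules[where w = "\<lambda>\<kappa>. if \<kappa> = \<nu> then d else 0"]) (simp add: z)
  then obtain p where p: "p \<in> symmetric_polys m" "z = poly_at scale m L p"
    using assms(3) by blast
  have "d = coef \<nu> z S S" using z assms by simp
  also have "\<dots> = poly_at (*) m (c \<nu> S) p" using coef_poly_at_L p assms by simp
  also have "\<dots> = poly_at (*) m (c \<mu> T) p" by (rule poly_at_symmetric[OF p(1) \<sigma>(1)]) (rule \<sigma>(2))
  also have "\<dots> = coef \<mu> z T T" using coef_poly_at_L p assms by simp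
  also have "\<dots> = 0" using z assms by simp
  finally show False using \<open>d \<noteq> 0\<close> by blast
qed

end
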